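(* Let $n\ge 1$. The kernel $K_{\text{peak}}(A,B)=J_{\text{peak}}(A,B)$ is positive semidefinite on $\mathbb{R}^n$. In particular, for any finite collection $\{A_1,\ldots,A_m\}\subset\mathbb{R}^n$ and any coefficients $c_1,\ldots,c_m\in\mathbb{R}$, $$\sum_{i=1}^m\sum_{j=1}^m c_ic_j\,K_{\text{peak}}(A_i,A_j)\ge 0.$$
   Context: For a real number $x$, write $x^+=\max\{x,0\}$ and $x^-=\max\{-x,0\}$; $\operatorname{sgn}(x)\in\{-1,0,+1\}$ is the sign function. For $A=(A_1,\dots,A_n)$, $B=(B_1,\dots,B_n)\in\mathbb{R}^n$ (here subscripts denote coordinates): - $\mathcal{I}_{\text{same}}(A,B)=\{i\in\{1,\dots,n\} : \operatorname{sgn}(A_i)=\operatorname{sgn}(B_i)\neq 0\}$; - $N(A,B)=\sum_{i\in\mathcal{I}_{\text{same}}(A,B)}\min(|A_i|,|B_i|)$; - $U_{\text{peak}}(A,B)=\sum_{i=1}^n\bigl(\max\{A_i^+,B_i^+\}+\max\{A_i^-,B_i^-\}\bigr)$; - $J_{\text{peak}}(A,B)=N(A,B)/U_{\text{peak}}(A,B)$ if $U_{\text{peak}}(A,B)>0$, and $J_{\text{peak}}(A,B)=1$ if $U_{\text{peak}}(A,B)=0$. In the claim, $A_1,\dots,A_m$ denote vectors in $\mathbb{R}^n$. *)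

theory Defs
  imports "HOL-Analysis.Analysis"
begin

definition pos_part :: "real \<Rightarrow> real" where
  "pos_part x = max x 0"

text \<open>The negative part is nonnegative, unlike \<open>nprt\<close> of \<open>HOL-Library.Lattice_Algebras\<close>.\<close>
definition neg_part :: "real \<Rightarrow> real" where
  "neg_part x = max (- x) 0"

definition I_same :: "real ^ 'n \<Rightarrow> real ^ 'n \<Rightarrow> 'n set" where
  "I_same A B = {i. sgn (A $ i) = sgn (B $ i) \<and> sgn (A $ i) \<noteq> 0}"

definition N_same :: "real ^ 'n \<Rightarrow> real ^ 'n \<Rightarrow> real" where
  "N_same A B = (\<Sum>i\<in>I_same A B. min \<bar>A $ i\<bar> \<bar>B $ i\<bar>)"

definition U_peak :: "real ^ 'n \<Rightarrow> real ^ 'n \<Rightarrow> real" where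
  "U_peak A B = (\<Sum>i\<in>UNIV. max (pos_part (A $ i)) (pos_part (B $ i))
                          + max (neg_part (A $ i)) (neg_part (B $ i)))"

text \<open>Every summand of \<^const>\<open>U_peak\<close> is nonnegative, so the last case is \<open>U_peak A B = 0\<close>.\<close>
definition J_peak :: "real ^ 'n \<Rightarrow> real ^ 'n \<Rightarrow> real" where
  "J_peak A B = (if U_peak A B > 0 then N_same A B / U_peak A B else 1)"

definition K_peak :: "real ^ 'n \<Rightarrow> real ^ 'n \<Rightarrow> real" where
  "K_peak A B = J_peak A B"

text \<open>A real positive semidefinite kernel is symmetric with nonnegative quadratic forms;
  over the reals, symmetry does not follow from the second condition. The points
  \<open>x 1, \<dots>, x m\<close> need not be distinct.\<close>
definition psd_kernel_on :: "'a set \<Rightarrow> ('a \<Rightarrow> 'a \<Rightarrow> real) \<Rightarrow> bool" where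
  "psd_kernel_on X K \<longleftrightarrow>
     (\<forall>x\<in>X. \<forall>y\<in>X. K x y = K y x) \<and>
     (\<forall>(m::nat) (x :: nat \<Rightarrow> 'a) (c :: nat \<Rightarrow> real). x ` {1..m} \<subseteq> X \<longrightarrow>
        (\<Sum>i=1..m. \<Sum>j=1..m. c i * c j * K (x i) (x j)) \<ge> 0)"

end

theory Submission
  imports Defs
begin

text \<open>
  Splitting coordinates into positive and negative parts turns \<open>K_peak\<close> into the weighted Jaccard
  kernel \<open>S / (s x + s y - S)\<close>, where \<open>S\<close> is a sum of kernels \<open>min (a x) (a y)\<close> and \<open>s\<close> is the
  \<open>\<ell>\<^sub>1\<close> norm. With \<open>R = S / (s x + s y)\<close> it equals \<open>R / (1 - R)\<close>, a geometric series in \<open>R\<close>.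
  The Cauchy kernel \<open>1 / (s x + s y)\<close> is a geometric series as well, by the Cayley transform.
  Instead of the Schur product theorem, the proof uses the class of kernels that multiply positive
  semidefinite kernels to positive semidefinite kernels: it is trivially closed under products,
  and contains the rank-one kernels and their mixtures.
\<close>

definition schur_multiplier_on :: "'a set \<Rightarrow> ('a \<Rightarrow> 'a \<Rightarrow> real) \<Rightarrow> bool" where
  "schur_multiplier_on X K \<longleftrightarrow>
     (\<forall>L. psd_kernel_on X L \<longrightarrow> psd_kernel_on X (\<lambda>x y. K x y * L x y))"

section \<open>Positive semidefinite kernels: sums, limits and mixtures\<close>

lemma psd_kernel_onI:
  assumes "\<And>x y. x \<in> X \<Longrightarrow> y \<in> X \<Longrightarrow> K x y = K y x"
    and "\<And>(m::nat) x (c :: nat \<Rightarrow> real). x ` {1..m} \<subseteq> X \<Longrightarrow>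
           (\<Sum>i=1..m. \<Sum>j=1..m. c i * c j * K (x i) (x j)) \<ge> 0"
  shows "psd_kernel_on X K"
  using assms unfolding psd_kernel_on_def by blast

lemma psd_kernel_on_sym:
  "psd_kernel_on X K \<Longrightarrow> x \<in> X \<Longrightarrow> y \<in> X \<Longrightarrow> K x y = K y x"
  unfolding psd_kernel_on_def by blast

lemma psd_kernel_on_sum_nonneg:
  fixes c :: "nat \<Rightarrow> real" and x :: "nat \<Rightarrow> 'a"
  assumes "psd_kernel_on X K" and "x ` {1..m} \<subseteq> X"
  shows "(\<Sum>i=1..m. \<Sum>j=1..m. c i * c j * K (x i) (x j)) \<ge> 0"
  using assms unfolding psd_kernel_on_def by blast

lemma psd_kernel_on_cong:
  fixes K :: "'a \<Rightarrow> 'a \<Rightarrow> real"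
  assumes "\<And>x y. x \<in> X \<Longrightarrow> y \<in> X \<Longrightarrow> K x y = K' x y" and K: "psd_kernel_on X K"
  shows "psd_kernel_on X K'"
proof (rule psd_kernel_onI)
  show "K' x y = K' y x" if "x \<in> X" "y \<in> X" for x y
    using assms(1) psd_kernel_on_sym[OF K] that by metis
next
  fix m :: nat and x :: "nat \<Rightarrow> 'a" and c :: "nat \<Rightarrow> real"
  assume x: "x ` {1..m} \<subseteq> X"
  have "(\<Sum>i=1..m. \<Sum>j=1..m. c i * c j * K' (x i) (x j)) =
        (\<Sum>i=1..m. \<Sum>j=1..m. c i * c j * K (x i) (x j))"
    using assms(1) x by (intro sum.cong refl) (auto simp: image_subset_iff)
  then show "(\<Sum>i=1..m. \<Sum>j=1..m. c i * c j * K' (x i) (x j)) \<ge> 0"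
    using psd_kernel_on_sum_nonneg[OF K x] by simp
qed

lemma psd_kernel_on_add:
  fixes K :: "'a \<Rightarrow> 'a \<Rightarrow> real"
  assumes "psd_kernel_on X K" and "psd_kernel_on X L"
  shows "psd_kernel_on X (\<lambda>x y. K x y + L x y)"
proof (rule psd_kernel_onI)
  show "K x y + L x y = K y x + L y x" if "x \<in> X" "y \<in> X" for x y
    using assms[THEN psd_kernel_on_sym] that by metis
next
  fix m :: nat and x :: "nat \<Rightarrow> 'a" and c :: "nat \<Rightarrow> real"
  assume x: "x ` {1..m} \<subseteq> X"
  show "(\<Sum>i=1..m. \<Sum>j=1..m. c i * c j * (K (x i) (x j) + L (x i) (x j))) \<ge> 0"
    using psd_kernel_on_sum_nonneg[OF assms(1) x, of c]
      psd_kernel_on_sum_nonneg[OF assms(2) x, of c]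
    by (simp add: distrib_left sum.distrib)
qed

lemma psd_kernel_on_const: "(c :: real) \<ge> 0 \<Longrightarrow> psd_kernel_on X (\<lambda>x y. c)"
proof (rule psd_kernel_onI)
  fix m :: nat and d :: "nat \<Rightarrow> real"
  assume "c \<ge> 0"
  have "(\<Sum>i=1..m. \<Sum>j=1..m. d i * d j * c) = (\<Sum>i=1..m. d i) * (\<Sum>i=1..m. d i) * c"
    by (simp add: sum_product flip: sum_distrib_right)
  then show "(\<Sum>i=1..m. \<Sum>j=1..m. d i * d j * c) \<ge> 0"
    using \<open>c \<ge> 0\<close> by simp
qed simp

text \<open>A quadratic form involves only finitely many kernel values, so pointwise convergence on
  \<open>X\<close> carries both symmetry and nonnegativity to the limit.\<close>

lemma psd_kernel_on_limit:
  fixes K :: "nat \<Rightarrow> 'a \<Rightarrow> 'a \<Rightarrow> real"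
  assumes psd: "\<And>n. psd_kernel_on X (K n)"
    and lim: "\<And>x y. x \<in> X \<Longrightarrow> y \<in> X \<Longrightarrow> (\<lambda>n. K n x y) \<longlonglongrightarrow> L x y"
  shows "psd_kernel_on X L"
proof (rule psd_kernel_onI)
  show "L x y = L y x" if "x \<in> X" "y \<in> X" for x y
  proof (rule LIMSEQ_unique)
    show "(\<lambda>n. K n x y) \<longlonglongrightarrow> L x y" using lim that by blast
    show "(\<lambda>n. K n x y) \<longlonglongrightarrow> L y x"
      using lim[of y x] psd_kernel_on_sym[OF psd] that by simp
  qed
next
  fix m :: nat and x :: "nat \<Rightarrow> 'a" and c :: "nat \<Rightarrow> real"
  assume x: "x ` {1..m} \<subseteq> X"
  have "(\<lambda>n. \<Sum>i=1..m. \<Sum>j=1..m. c i * c j * K n (x i) (x j))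
      \<longlonglongrightarrow> (\<Sum>i=1..m. \<Sum>j=1..m. c i * c j * L (x i) (x j))"
    using lim x by (intro tendsto_intros) (auto simp: image_subset_iff)
  then show "(\<Sum>i=1..m. \<Sum>j=1..m. c i * c j * L (x i) (x j)) \<ge> 0"
    by (rule LIMSEQ_le_const) (use psd_kernel_on_sum_nonneg[OF psd x] in blast)
qed

text \<open>Integrability lets the finite double sum pass through the integral, so the quadratic
  form of the mixture is the integral of nonnegative quadratic forms.\<close>

lemma psd_kernel_on_integral:
  fixes K :: "'b \<Rightarrow> 'a \<Rightarrow> 'a \<Rightarrow> real"
  assumes psd: "\<And>t. psd_kernel_on X (K t)"
    and int: "\<And>x y. x \<in> X \<Longrightarrow> y \<in> X \<Longrightarrow> integrable M (\<lambda>t. K t x y)"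
  shows "psd_kernel_on X (\<lambda>x y. \<integral>t. K t x y \<partial>M)"
proof (rule psd_kernel_onI)
  show "(\<integral>t. K t x y \<partial>M) = (\<integral>t. K t y x \<partial>M)" if "x \<in> X" "y \<in> X" for x y
    using psd_kernel_on_sym[OF psd] that by simp
next
  fix m :: nat and x :: "nat \<Rightarrow> 'a" and c :: "nat \<Rightarrow> real"
  assume x: "x ` {1..m} \<subseteq> X"
  have int': "integrable M (\<lambda>t. c i * c j * K t (x i) (x j))" if "i \<in> {1..m}" "j \<in> {1..m}" for i j
    using int x that by (intro integrable_mult_right) (auto simp: image_subset_iff)
  have "0 \<le> (\<integral>t. (\<Sum>i=1..m. \<Sum>j=1..m. c i * c j * K t (x i) (x j)) \<partial>M)"
    using psd_kernel_on_sum_nonneg[OF psd x] by simp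
  also have "\<dots> = (\<Sum>i=1..m. \<integral>t. (\<Sum>j=1..m. c i * c j * K t (x i) (x j)) \<partial>M)"
    by (intro Bochner_Integration.integral_sum Bochner_Integration.integrable_sum int')
  also have "\<dots> = (\<Sum>i=1..m. \<Sum>j=1..m. \<integral>t. c i * c j * K t (x i) (x j) \<partial>M)"
    by (intro sum.cong refl Bochner_Integration.integral_sum int')
  finally show "(\<Sum>i=1..m. \<Sum>j=1..m. c i * c j * (\<integral>t. K t (x i) (x j) \<partial>M)) \<ge> 0"
    by simp
qed

section \<open>Closure properties of Schur multipliers\<close>

lemma schur_multiplier_onI:
  "(\<And>L. psd_kernel_on X L \<Longrightarrow> psd_kernel_on X (\<lambda>x y. K x y * L x y)) \<Longrightarrow> schur_multiplier_on X K"
  unfolding schur_multiplier_on_def by blast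

lemma schur_multiplier_onD:
  "schur_multiplier_on X K \<Longrightarrow> psd_kernel_on X L \<Longrightarrow> psd_kernel_on X (\<lambda>x y. K x y * L x y)"
  unfolding schur_multiplier_on_def by blast

text \<open>Multiply the constant kernel 1, which is itself positive semidefinite.\<close>

lemma schur_multiplier_on_imp_psd: "schur_multiplier_on X K \<Longrightarrow> psd_kernel_on X K"
  using schur_multiplier_onD[OF _ psd_kernel_on_const[of 1]] by simp

lemma schur_multiplier_on_cong:
  assumes eq: "\<And>x y. x \<in> X \<Longrightarrow> y \<in> X \<Longrightarrow> K x y = K' x y" and K: "schur_multiplier_on X K"
  shows "schur_multiplier_on X K'"
proof (rule schur_multiplier_onI)
  fix L assume "psd_kernel_on X L"
  from schur_multiplier_onD[OF K this] show "psd_kernel_on X (\<lambda>x y. K' x y * L x y)"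
    by (rule psd_kernel_on_cong[rotated]) (simp add: eq)
qed

text \<open>The factors \<open>f (x i)\<close> are absorbed into the coefficients: the form of the
  product at \<open>c i\<close> is the form of \<open>L\<close> at
  \<open>c i * f (x i)\<close>.\<close>

lemma schur_multiplier_on_rank_one:
  fixes f :: "'a \<Rightarrow> real"
  shows "schur_multiplier_on X (\<lambda>x y. f x * f y)"
proof (intro schur_multiplier_onI psd_kernel_onI)
  fix L :: "'a \<Rightarrow> 'a \<Rightarrow> real" assume L: "psd_kernel_on X L"
  show "f x * f y * L x y = f y * f x * L y x" if "x \<in> X" "y \<in> X" for x y
    using psd_kernel_on_sym[OF L that] by simp
  fix m :: nat and x :: "nat \<Rightarrow> 'a" and c :: "nat \<Rightarrow> real"
  assume x: "x ` {1..m} \<subseteq> X"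
  show "(\<Sum>i=1..m. \<Sum>j=1..m. c i * c j * (f (x i) * f (x j) * L (x i) (x j))) \<ge> 0"
    using psd_kernel_on_sum_nonneg[OF L x, of "\<lambda>i. c i * f (x i)"] by (simp add: mult_ac)
qed

lemma schur_multiplier_on_const: "c \<ge> 0 \<Longrightarrow> schur_multiplier_on X (\<lambda>x y. c)"
  using schur_multiplier_on_rank_one[of X "\<lambda>_. sqrt c"] by simp

lemma schur_multiplier_on_add:
  "schur_multiplier_on X K \<Longrightarrow> schur_multiplier_on X L \<Longrightarrow>
    schur_multiplier_on X (\<lambda>x y. K x y + L x y)"
  by (simp add: schur_multiplier_on_def distrib_right psd_kernel_on_add)

lemma schur_multiplier_on_sum:
  "(\<And>i. i \<in> I \<Longrightarrow> schur_multiplier_on X (K i)) \<Longrightarrow> schur_multiplier_on X (\<lambda>x y. \<Sum>i\<in>I. K i x y)"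
  by (induction I rule: infinite_finite_induct)
    (simp_all add: schur_multiplier_on_const schur_multiplier_on_add)

text \<open>By associativity the two multipliers act one after the other.\<close>

lemma schur_multiplier_on_mult:
  "schur_multiplier_on X K \<Longrightarrow> schur_multiplier_on X L \<Longrightarrow>
    schur_multiplier_on X (\<lambda>x y. K x y * L x y)"
  by (simp add: schur_multiplier_on_def mult.assoc)

lemma schur_multiplier_on_power:
  "schur_multiplier_on X K \<Longrightarrow> schur_multiplier_on X (\<lambda>x y. K x y ^ n)"
  by (induction n) (simp_all add: schur_multiplier_on_const schur_multiplier_on_mult)

lemma schur_multiplier_on_limit:
  assumes "\<And>n :: nat. schur_multiplier_on X (K n)"
    and "\<And>x y. x \<in> X \<Longrightarrow> y \<in> X \<Longrightarrow> (\<lambda>n. K n x y) \<longlonglongrightarrow> L x y"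
  shows "schur_multiplier_on X L"
proof (rule schur_multiplier_onI)
  fix H assume H: "psd_kernel_on X H"
  show "psd_kernel_on X (\<lambda>x y. L x y * H x y)"
  proof (rule psd_kernel_on_limit)
    show "psd_kernel_on X (\<lambda>x y. K n x y * H x y)" for n
      using assms(1) H by (rule schur_multiplier_onD)
    show "(\<lambda>n. K n x y * H x y) \<longlonglongrightarrow> L x y * H x y" if "x \<in> X" "y \<in> X" for x y
      by (intro tendsto_mult_right assms(2) that)
  qed
qed

lemma schur_multiplier_on_integral:
  assumes "\<And>t. schur_multiplier_on X (K t)"
    and "\<And>x y. x \<in> X \<Longrightarrow> y \<in> X \<Longrightarrow> integrable M (\<lambda>t. K t x y)"
  shows "schur_multiplier_on X (\<lambda>x y. \<integral>t. K t x y \<partial>M)"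
proof (rule schur_multiplier_onI)
  fix H assume "psd_kernel_on X H"
  then have "psd_kernel_on X (\<lambda>x y. \<integral>t. K t x y * H x y \<partial>M)"
    using assms by (intro psd_kernel_on_integral schur_multiplier_onD integrable_mult_left)
  then show "psd_kernel_on X (\<lambda>x y. (\<integral>t. K t x y \<partial>M) * H x y)"
    by simp
qed

section \<open>Geometric, Cauchy, minimum and Jaccard kernels\<close>

lemma schur_multiplier_on_geometric:
  assumes "schur_multiplier_on X K" and "\<And>x y. x \<in> X \<Longrightarrow> y \<in> X \<Longrightarrow> \<bar>K x y\<bar> < 1"
  shows "schur_multiplier_on X (\<lambda>x y. 1 / (1 - K x y))"
proof (rule schur_multiplier_on_limit)
  show "schur_multiplier_on X (\<lambda>x y. \<Sum>k<n. K x y ^ k)" for n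
    by (intro schur_multiplier_on_sum schur_multiplier_on_power assms)
  show "(\<lambda>n. \<Sum>k<n. K x y ^ k) \<longlonglongrightarrow> 1 / (1 - K x y)" if "x \<in> X" "y \<in> X" for x y
    using geometric_sums[of "K x y"] assms(2)[OF that] by (simp add: sums_def)
qed

lemma schur_multiplier_on_cauchy:
  assumes pos: "\<And>x. x \<in> X \<Longrightarrow> a x > 0"
  shows "schur_multiplier_on X (\<lambda>x y. 1 / (a x + a y))"
proof -
  \<comment> \<open>The Cayley transform sends positive numbers into (-1, 1) and turns
    \<open>1 / (a x + a y)\<close> into \<open>1 / (1 - u x * u y)\<close>, up to the factor
    \<open>1/2\<close> and the rank-one weight \<open>(1 - u x) * (1 - u y)\<close>.\<close>
  define u where "u x = (a x - 1) / (a x + 1)" for x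
  have u: "\<bar>u x\<bar> < 1" if "x \<in> X" for x
    using pos[OF that] by (simp add: u_def abs_less_iff field_simps)
  have "\<bar>u x * u y\<bar> < 1" if "x \<in> X" "y \<in> X" for x y
    using abs_mult_less[OF u u, OF that] by (simp add: abs_mult)
  then have "schur_multiplier_on X (\<lambda>x y. 1 / (1 - u x * u y))"
    by (rule schur_multiplier_on_geometric[OF schur_multiplier_on_rank_one])
  then have "schur_multiplier_on X
      (\<lambda>x y. 1/2 * ((1 - u x) * (1 - u y)) * (1 / (1 - u x * u y)))"
    by (intro schur_multiplier_on_mult[of X "\<lambda>x y. 1/2 * ((1 - u x) * (1 - u y))"]
        schur_multiplier_on_mult[of X "\<lambda>x y. 1/2"]
        schur_multiplier_on_const schur_multiplier_on_rank_one[where f = "\<lambda>x. 1 - u x"]) simp_all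
  then show ?thesis
  proof (rule schur_multiplier_on_cong[rotated])
    fix x y assume "x \<in> X" "y \<in> X"
    then have a: "a x > 0" "a y > 0" using pos by auto
    have "1 - u x = 2 / (a x + 1)" "1 - u y = 2 / (a y + 1)"
      using a by (simp_all add: u_def field_simps)
    moreover have "1 - u x * u y = 2 * (a x + a y) / ((a x + 1) * (a y + 1))"
      using a by (simp add: u_def divide_simps) (simp add: algebra_simps)
    ultimately show "1/2 * ((1 - u x) * (1 - u y)) * (1 / (1 - u x * u y)) = 1 / (a x + a y)"
      using a by simp (simp add: field_simps)
  qed
qed

lemma schur_multiplier_on_min:
  fixes a :: "'a \<Rightarrow> real"
  assumes nonneg: "\<And>x. x \<in> X \<Longrightarrow> a x \<ge> 0"
  shows "schur_multiplier_on X (\<lambda>x y. min (a x) (a y))"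
proof -
  \<comment> \<open>The minimum is the length of the intersection of the intervals
    \<open>{0..a x}\<close> and \<open>{0..a y}\<close>, hence a mixture over \<open>t\<close> of
    rank-one kernels.\<close>
  define F :: "real \<Rightarrow> 'a \<Rightarrow> real" where "F t x = indicator {0..a x} t" for t x
  have F: "F t x * F t y = indicator {0..min (a x) (a y)} t" for t x y
    by (auto simp: F_def indicator_def)
  have "schur_multiplier_on X (\<lambda>x y. \<integral>t. F t x * F t y \<partial>lborel)"
    by (intro schur_multiplier_on_integral schur_multiplier_on_rank_one)
      (simp add: F emeasure_lborel_Icc_eq)
  then show ?thesis
    by (rule schur_multiplier_on_cong[rotated]) (simp add: F nonneg)
qed

text \<open>Where \<open>s x = s y = 0\<close>, the kernel below has the junk value \<open>0 / 0 = 0\<close>.\<close>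

lemma schur_multiplier_on_jaccard:
  assumes S: "schur_multiplier_on X S"
    and nonneg: "\<And>x y. x \<in> X \<Longrightarrow> y \<in> X \<Longrightarrow> 0 \<le> S x y"
    and le: "\<And>x y. x \<in> X \<Longrightarrow> y \<in> X \<Longrightarrow> S x y \<le> min (s x) (s y)"
  shows "schur_multiplier_on X (\<lambda>x y. S x y / (s x + s y - S x y))"
proof -
  \<comment> \<open>The Cauchy kernel needs strictly positive weights. Replacing 0 by 1 is harmless,
    because \<open>S x y\<close> vanishes as soon as \<open>s x\<close> or \<open>s y\<close> does;
    the value 1 is arbitrary among positive numbers.\<close>
  define s' where "s' x = (if s x = 0 then 1 else s x)" for x
  have s: "s x \<ge> 0" if "x \<in> X" for x
    using nonneg[OF that that] le[OF that that] by simp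
  have s': "s' x > 0" if "x \<in> X" for x
    using s[OF that] by (simp add: s'_def)
  have le': "S x y \<le> min (s' x) (s' y)" if "x \<in> X" "y \<in> X" for x y
    using le[OF that] by (auto simp: s'_def)
  define R where "R x y = S x y * (1 / (s' x + s' y))" for x y
  have R: "schur_multiplier_on X R"
    unfolding R_def by (intro schur_multiplier_on_mult S schur_multiplier_on_cauchy s')
  \<comment> \<open>A minimum is at most the average, so \<open>R x y\<close> even lies between 0
    and 1/2.\<close>
  have R_less: "\<bar>R x y\<bar> < 1" if "x \<in> X" "y \<in> X" for x y
    using nonneg[OF that] le'[OF that] s'[OF that(1)] s'[OF that(2)] by (simp add: R_def)
  have "schur_multiplier_on X (\<lambda>x y. R x y * (1 / (1 - R x y)))"
    by (intro schur_multiplier_on_mult schur_multiplier_on_geometric R R_less)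
  then show ?thesis
  proof (rule schur_multiplier_on_cong[rotated])
    fix x y assume xy: "x \<in> X" "y \<in> X"
    show "R x y * (1 / (1 - R x y)) = S x y / (s x + s y - S x y)"
    proof (cases "s x = 0 \<or> s y = 0")
      case True
      then have "S x y = 0" using nonneg[OF xy] le[OF xy] by auto
      then show ?thesis by (simp add: R_def)
    next
      case False
      then have "s x > 0" "s y > 0" using s xy by (simp_all add: less_le)
      then show ?thesis
        using False le[OF xy] by (simp add: R_def s'_def diff_divide_eq_iff)
    qed
  qed
qed

section \<open>The peak kernel as a Jaccard kernel\<close>

lemma N_same_eq_sum_min:
  "N_same A B = (\<Sum>i\<in>UNIV. min (pos_part (A $ i)) (pos_part (B $ i))
                         + min (neg_part (A $ i)) (neg_part (B $ i)))"
proof -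
  have "N_same A B = (\<Sum>i\<in>UNIV. if i \<in> I_same A B then min \<bar>A $ i\<bar> \<bar>B $ i\<bar> else 0)"
    unfolding N_same_def by (simp add: sum.If_cases)
  \<comment> \<open>If the signs agree and are nonzero, one of the two minima is
    \<open>min \<bar>A $ i\<bar> \<bar>B $ i\<bar>\<close> and the other is 0; otherwise both are
    0.\<close>
  also have "\<dots> = (\<Sum>i\<in>UNIV. min (pos_part (A $ i)) (pos_part (B $ i))
                         + min (neg_part (A $ i)) (neg_part (B $ i)))"
    by (intro sum.cong refl)
      (auto simp: I_same_def pos_part_def neg_part_def sgn_if min_def max_def split: if_splits)
  finally show ?thesis .
qed

lemma N_same_nonneg: "0 \<le> N_same A B"
  by (simp add: N_same_def sum_nonneg)

text \<open>Each minimum is at most either argument, and positive and negative part add up to the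
  absolute value. This is the domination that the Jaccard lemma asks for.\<close>

lemma N_same_le: "N_same A B \<le> min (\<Sum>i\<in>UNIV. \<bar>A $ i\<bar>) (\<Sum>i\<in>UNIV. \<bar>B $ i\<bar>)"
  unfolding N_same_eq_sum_min
  by (intro min.boundedI sum_mono) (auto simp: pos_part_def neg_part_def)

text \<open>Inclusion-exclusion: the maximum and the minimum of two numbers add up to their
  sum.\<close>

lemma U_peak_eq: "U_peak A B = (\<Sum>i\<in>UNIV. \<bar>A $ i\<bar>) + (\<Sum>i\<in>UNIV. \<bar>B $ i\<bar>) - N_same A B"
  unfolding U_peak_def N_same_eq_sum_min sum.distrib[symmetric] sum_subtractf[symmetric]
  by (intro sum.cong refl) (auto simp: pos_part_def neg_part_def max_def min_def)

lemma schur_multiplier_on_N_same: "schur_multiplier_on X N_same"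
proof -
  have "schur_multiplier_on X (\<lambda>A B. \<Sum>i\<in>UNIV. min (pos_part (A $ i)) (pos_part (B $ i))
                                   + min (neg_part (A $ i)) (neg_part (B $ i)))"
    by (intro schur_multiplier_on_sum schur_multiplier_on_add schur_multiplier_on_min)
      (simp_all add: pos_part_def neg_part_def)
  then show ?thesis
    by (rule schur_multiplier_on_cong[rotated]) (simp add: N_same_eq_sum_min)
qed

lemma U_peak_nonneg: "0 \<le> U_peak A B"
  using N_same_le[of A B] N_same_nonneg[of A B] by (simp add: U_peak_eq)

lemma U_peak_eq_0_iff: "U_peak A B = 0 \<longleftrightarrow> A = 0 \<and> B = 0"
proof
  assume "U_peak A B = 0"
  \<comment> \<open>Since \<open>N_same A B\<close> is at most the smaller norm,
    \<open>U_peak A B\<close> is at least the larger one.\<close>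
  then have "(\<Sum>i\<in>UNIV. \<bar>A $ i\<bar>) = 0" "(\<Sum>i\<in>UNIV. \<bar>B $ i\<bar>) = 0"
    using N_same_le[of A B] N_same_nonneg[of A B] unfolding U_peak_eq by auto
  then show "A = 0 \<and> B = 0"
    by (simp add: sum_nonneg_eq_0_iff vec_eq_iff)
qed (simp add: U_peak_def pos_part_def neg_part_def)

text \<open>The convention \<open>J_peak 0 0 = 1\<close> adds a rank-one kernel supported at the origin.\<close>

lemma K_peak_eq:
  "K_peak A B = N_same A B / U_peak A B + of_bool (A = 0) * of_bool (B = 0)"
  using U_peak_nonneg[of A B] U_peak_eq_0_iff[of A B] by (auto simp: K_peak_def J_peak_def)

lemma psd_kernel_on_K_peak: "psd_kernel_on X K_peak"
proof -
  have "schur_multiplier_on X (\<lambda>A B. N_same A B / U_peak A B + of_bool (A = 0) * of_bool (B = 0))"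
    unfolding U_peak_eq
    by (intro schur_multiplier_on_add schur_multiplier_on_jaccard schur_multiplier_on_rank_one
        schur_multiplier_on_N_same N_same_nonneg N_same_le)
  then show ?thesis
    by (intro schur_multiplier_on_imp_psd) (simp add: K_peak_eq[abs_def])
qed

theorem theorem3p15:
  shows "psd_kernel_on (UNIV :: (real ^ 'n) set) K_peak \<and>
    (\<forall>(m::nat) (A :: nat \<Rightarrow> real ^ 'n) (c :: nat \<Rightarrow> real).
       (\<Sum>i=1..m. \<Sum>j=1..m. c i * c j * K_peak (A i) (A j)) \<ge> 0)"
  using psd_kernel_on_sum_nonneg[OF psd_kernel_on_K_peak[of UNIV]] psd_kernel_on_K_peak
  by blast

end
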